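(* Let $q\in\mathbb{C}$ with $|q|<1$ and let $x\in\mathbb{C}^*$ be such that all quantities below are defined (no vanishing denominators). Then \[ j\bigl(-xq;q^2\bigr)g_{3,c}\bigl(xq,q^2\bigr)+j\bigl(xq;q^2\bigr)g_{3,c}\bigl(-xq,q^2\bigr)=\frac{4J_4^5}{J_2^2\,j\bigl(x^2q^2;q^4\bigr)}. \]
   Context: For $n\in\mathbb{Z}\cup\{\infty\}$: $(a;q)_\infty=\prod_{j\ge0}(1-aq^j)$ and $(a;q)_n=(a;q)_\infty/(aq^n;q)_\infty$ (so for $n<0$, $(a;q)_n=1/\bigl((1-aq^{-1})\cdots(1-aq^{n})\bigr)$); $(a_1,\dots,a_m;q)_n=(a_1;q)_n\cdots(a_m;q)_n$. Theta function: $j(z;q)=(z,q/z,q;q)_\infty$, and $J_m=(q^m;q^m)_\infty$. The bilateral two-parameter mock theta function is $g_{3,c}(x,q)=\sum_{n=-\infty}^{\infty}\frac{q^{n^2+n}}{(x,q/x;q)_{n+1}}$. *)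

theory Defs
  imports "HOL-Analysis.Analysis"
begin

definition qpoch_inf :: "complex \<Rightarrow> complex \<Rightarrow> complex" where
  "qpoch_inf a q = (\<Prod>j. 1 - a * q ^ j)"

text \<open>
  The index ranges over all integers. If the denominator vanishes, the value is 0 by the
  convention for division in HOL; hence \<open>qpoch a q n \<noteq> 0\<close> says both that the
  symbol is defined and that it does not vanish.
\<close>
definition qpoch :: "complex \<Rightarrow> complex \<Rightarrow> int \<Rightarrow> complex" where
  "qpoch a q n = qpoch_inf a q / qpoch_inf (a * q powi n) q"

definition qpochs_inf :: "complex list \<Rightarrow> complex \<Rightarrow> complex" where
  "qpochs_inf as q = (\<Prod>a\<leftarrow>as. qpoch_inf a q)"

definition qpochs :: "complex list \<Rightarrow> complex \<Rightarrow> int \<Rightarrow> complex" where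
  "qpochs as q n = (\<Prod>a\<leftarrow>as. qpoch a q n)"

definition jtheta :: "complex \<Rightarrow> complex \<Rightarrow> complex" where
  "jtheta z q = qpochs_inf [z, q / z, q] q"

definition Jfun :: "complex \<Rightarrow> nat \<Rightarrow> complex" where
  "Jfun q m = qpoch_inf (q ^ m) (q ^ m)"

definition g3c :: "complex \<Rightarrow> complex \<Rightarrow> complex" where
  "g3c x q = (\<Sum>\<^sub>\<infinity>n\<in>(UNIV :: int set). q powi (n\<^sup>2 + n) / qpochs [x, q / x] q (n + 1))"

end

theory Submission
  imports Defs "HOL-Complex_Analysis.Complex_Analysis"
begin

text \<open>
  Work in base \<open>q\<close> and put \<open>theta z = (z, q/z; q)\<^sub>\<infinity>\<close>. Clearing denominators gives
  \<open>g3c z = hsum z / theta z\<close> with \<open>hsum\<close> analytic away from 0, and a telescoping argument yields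
  \<open>z * hsum z = bsum z - (theta z)\<^sup>2\<close>, where \<open>bsum z = bsum (1/z)\<close>. Combined with
  \<open>hsum (q/z) = hsum z\<close>, this shows that
  \<open>E z = ((theta (-z))\<^sup>2 * bsum z - (theta z)\<^sup>2 * bsum (-z)) / z\<close> is invariant under \<open>z \<mapsto> q z\<close>.
  Hence \<open>E\<close> is constant by Liouville's theorem, and \<open>E 1\<close> is evaluated by Durfee's identity
  \<open>(\<Sum>n. q^(n^2) / ((q; q)\<^sub>n)\<^sup>2) = 1 / (q; q)\<^sub>\<infinity>\<close>.
\<close>

section \<open>Unordered sums over the integers\<close>

lemma int_halves:
  shows "range int \<union> range (\<lambda>m. - int m - 1) = UNIV"
    and "range int \<inter> range (\<lambda>m. - int m - 1) = {}"
proof -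
  have "x \<in> range int \<union> range (\<lambda>m. - int m - 1)" for x
  proof (cases "x \<ge> 0")
    case True
    then have "x = int (nat x)" by simp
    then show ?thesis by blast
  next
    case False
    then have "x = - int (nat (- x - 1)) - 1" by simp
    then show ?thesis by blast
  qed
  then show "range int \<union> range (\<lambda>m. - int m - 1) = UNIV" by blast
  show "range int \<inter> range (\<lambda>m. - int m - 1) = {}" by auto
qed

text \<open>Geometric majorants make both halves absolutely convergent, so the unordered sum may be
  computed as two ordinary series. That form is what the termwise holomorphy argument for
  \<open>bsum\<close> needs.\<close>

lemma bilateral_summable:
  fixes F :: "int \<Rightarrow> 'a :: banach"
  assumes r: "0 \<le> r" "r < 1"
    and nonneg: "\<And>n. norm (F (int n)) \<le> C * r ^ n"
    and neg: "\<And>m. norm (F (- int m - 1)) \<le> C * r ^ m"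
  shows "F summable_on UNIV"
    and "infsum F UNIV = (\<Sum>n. F (int n)) + (\<Sum>m. F (- int m - 1))"
proof -
  have g: "summable (\<lambda>n. C * r ^ n)"
    using r by (intro summable_mult summable_geometric) auto
  have s1: "summable (\<lambda>n. norm (F (int n)))"
    by (rule summable_comparison_test'[OF g, where N = 0]) (use nonneg in auto)
  have s2: "summable (\<lambda>m. norm (F (- int m - 1)))"
    by (rule summable_comparison_test'[OF g, where N = 0]) (use neg in auto)
  have h1: "((F \<circ> int) has_sum (\<Sum>n. F (int n))) UNIV"
    using norm_summable_imp_has_sum[OF s1] summable_norm_cancel[OF s1] by (simp add: o_def summable_sums)
  have h2: "((F \<circ> (\<lambda>m. - int m - 1)) has_sum (\<Sum>m. F (- int m - 1))) UNIV"
    using norm_summable_imp_has_sum[OF s2] summable_norm_cancel[OF s2] by (simp add: o_def summable_sums)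
  have i1: "(F has_sum (\<Sum>n. F (int n))) (range int)"
    using h1 by (subst has_sum_reindex) (auto simp: inj_on_def)
  have i2: "(F has_sum (\<Sum>m. F (- int m - 1))) (range (\<lambda>m. - int m - 1))"
    using h2 by (subst has_sum_reindex) (auto simp: inj_on_def)
  have "(F has_sum ((\<Sum>n. F (int n)) + (\<Sum>m. F (- int m - 1)))) UNIV"
    using has_sum_Un_disjoint[OF i1 i2] int_halves by simp
  then show "F summable_on UNIV" "infsum F UNIV = (\<Sum>n. F (int n)) + (\<Sum>m. F (- int m - 1))"
    by (auto simp: summable_on_def infsumI)
qed

text \<open>Cutting at 0, the upper half telescopes to \<open>u 0\<close> and the lower half to
  \<open>L - u 0\<close>. The limit of \<open>u\<close> at minus infinity may be nonzero, so
  \<open>u\<close> itself need not be summable.\<close>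

lemma has_sum_telescope_int:
  fixes u :: "int \<Rightarrow> complex"
  assumes has_sum: "((\<lambda>n. u n - u (n + 1)) has_sum S) UNIV"
    and top: "(\<lambda>n. u (int n)) \<longlonglongrightarrow> 0"
    and bot: "(\<lambda>m. u (- int m)) \<longlonglongrightarrow> L"
  shows "S = L"
proof -
  let ?F = "\<lambda>n. u n - u (n + 1)"
  have s: "?F summable_on A" for A
    using has_sum summable_on_subset_banach[of ?F UNIV A] by (auto simp: summable_on_def)
  have e1: "(?F has_sum u 0) (range int)"
  proof -
    have "(?F \<circ> int) summable_on UNIV"
      using s[of "range int"] summable_on_reindex[of int UNIV ?F] by (simp add: inj_on_def)
    then obtain a where a: "((?F \<circ> int) has_sum a) UNIV" by (auto simp: summable_on_def)
    have "(\<lambda>n. u (int n) - u (int (Suc n))) sums (u (int 0) - 0)"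
      by (rule telescope_sums'[OF top])
    then have "(?F \<circ> int) sums u 0" by (simp add: o_def add.commute)
    with has_sum_imp_sums[OF a] have "a = u 0" using sums_unique2 by blast
    with a show ?thesis by (subst has_sum_reindex) (auto simp: inj_on_def)
  qed
  have e2: "(?F has_sum (L - u 0)) (range (\<lambda>m. - int m - 1))"
  proof -
    let ?i = "\<lambda>m::nat. - int m - 1"
    have inj: "inj ?i" by (auto simp: inj_on_def)
    have "(?F \<circ> ?i) summable_on UNIV"
      using s[of "range ?i"] summable_on_reindex[OF inj, of ?F] by simp
    then obtain a where a: "((?F \<circ> ?i) has_sum a) UNIV" by (auto simp: summable_on_def)
    have "(\<lambda>m. u (- int (Suc m)) - u (- int m)) sums (L - u (- int 0))"
      by (rule telescope_sums[OF bot])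
    then have "(?F \<circ> ?i) sums (L - u 0)" by (simp add: o_def minus_diff_commute)
    with has_sum_imp_sums[OF a] have "a = L - u 0" using sums_unique2 by blast
    with a show ?thesis using has_sum_reindex[OF inj, of ?F "L - u 0"] by simp
  qed
  have "(?F has_sum (u 0 + (L - u 0))) UNIV"
    using has_sum_Un_disjoint[OF e1 e2] int_halves by simp
  then show ?thesis using has_sum_unique[OF has_sum] by simp
qed

section \<open>Finite and infinite q-Pochhammer products\<close>

text \<open>A division-free form of \<open>(a; q)_n\<close>: it is a polynomial in \<open>a\<close>
  and keeps its meaning where \<open>qpoch_inf a q\<close> vanishes, unlike the quotient in
  \<open>qpoch\<close>.\<close>

definition qpoch_fin :: "complex \<Rightarrow> complex \<Rightarrow> nat \<Rightarrow> complex" where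
  "qpoch_fin a q n = (\<Prod>j<n. 1 - a * q ^ j)"

context
  fixes q :: complex
  assumes q1: "norm q < 1"
begin

lemma norm_sum_le: "(\<Sum>j<n. norm a * norm q ^ j) \<le> norm a / (1 - norm q)"
proof -
  have "(\<Sum>j<n. norm a * norm q ^ j) = norm a * (\<Sum>j<n. norm q ^ j)"
    by (simp add: sum_distrib_left)
  also have "(\<Sum>j<n. norm q ^ j) \<le> (\<Sum>j. norm q ^ j)"
    by (rule sum_le_suminf) (use q1 in \<open>auto intro: summable_geometric\<close>)
  also have "(\<Sum>j. norm q ^ j) = 1 / (1 - norm q)"
    using q1 by (intro suminf_geometric) auto
  finally show ?thesis by (simp add: mult_left_mono)
qed

text \<open>By \<open>1 + t \<le> exp t\<close> the product is controlled by a geometric sum. The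
  bound is uniform in \<open>n\<close>, hence passes to the infinite product.\<close>

lemma norm_qpoch_fin_le:
  assumes "norm a \<le> K"
  shows "norm (qpoch_fin a q n) \<le> exp (K / (1 - norm q))"
proof -
  have "norm (qpoch_fin a q n) = (\<Prod>j<n. norm (1 - a * q ^ j))"
    by (simp add: qpoch_fin_def prod_norm)
  also have "\<dots> \<le> (\<Prod>j<n. 1 + norm a * norm q ^ j)"
    by (intro prod_mono conjI norm_ge_zero order.trans[OF norm_triangle_ineq4])
       (simp add: norm_mult norm_power)
  also have "\<dots> \<le> exp (\<Sum>j<n. norm a * norm q ^ j)"
    by (rule prod_le_exp_sum) simp
  also have "\<dots> \<le> exp (K / (1 - norm q))"
    using norm_sum_le[of a n] assms q1 by (simp add: order.trans[OF _ divide_right_mono])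
  finally show ?thesis .
qed

lemma convergent_qpoch: "convergent_prod (\<lambda>j. 1 - a * q ^ j)"
proof -
  have "summable (\<lambda>j. norm (- (a * q ^ j)))"
    using q1 by (simp add: norm_mult norm_power summable_mult)
  then have "convergent_prod (\<lambda>j. 1 + - (a * q ^ j))"
    by (intro abs_convergent_prod_imp_convergent_prod summable_imp_abs_convergent_prod) simp
  then show ?thesis by simp
qed

lemma qpoch_fin_tendsto: "(\<lambda>n. qpoch_fin a q n) \<longlonglongrightarrow> qpoch_inf a q"
proof -
  have "(\<lambda>n. \<Prod>j\<le>n. 1 - a * q ^ j) \<longlonglongrightarrow> qpoch_inf a q"
    using convergent_prod_LIMSEQ[OF convergent_qpoch] by (simp add: qpoch_inf_def)
  then have "(\<lambda>n. qpoch_fin a q (Suc n)) \<longlonglongrightarrow> qpoch_inf a q"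
    by (simp add: qpoch_fin_def lessThan_Suc_atMost)
  then show ?thesis by (rule LIMSEQ_imp_Suc)
qed

lemma norm_qpoch_inf_le:
  assumes "norm a \<le> K"
  shows "norm (qpoch_inf a q) \<le> exp (K / (1 - norm q))"
  using norm_qpoch_fin_le[OF assms]
  by (intro LIMSEQ_le_const2[OF tendsto_norm[OF qpoch_fin_tendsto]]) auto

lemma qpoch_fin_rec: "qpoch_fin a q (Suc n) = (1 - a) * qpoch_fin (a * q) q n"
  unfolding qpoch_fin_def by (subst prod.lessThan_Suc_shift) (simp add: mult.assoc)

lemma qpoch_inf_rec: "qpoch_inf a q = (1 - a) * qpoch_inf (a * q) q"
proof (rule LIMSEQ_unique)
  show "(\<lambda>n. qpoch_fin a q (Suc n)) \<longlonglongrightarrow> qpoch_inf a q"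
    by (rule LIMSEQ_Suc[OF qpoch_fin_tendsto])
  show "(\<lambda>n. qpoch_fin a q (Suc n)) \<longlonglongrightarrow> (1 - a) * qpoch_inf (a * q) q"
    unfolding qpoch_fin_rec by (intro tendsto_intros qpoch_fin_tendsto)
qed

lemma qpoch_inf_0 [simp]: "qpoch_inf 0 q = 1"
  by (simp add: qpoch_inf_def)

lemma qpoch_inf_1 [simp]: "qpoch_inf 1 q = 0"
  by (subst qpoch_inf_rec) simp

lemma qpoch_inf_q_nonzero: "qpoch_inf q q \<noteq> 0"
  unfolding qpoch_inf_def
proof (rule prodinf_nonzero[OF convergent_qpoch])
  fix j
  have "norm (q * q ^ j) < 1"
    using q1 power_Suc_less_one[of "norm q" j] 
    by (cases "q = 0") (auto simp: norm_mult norm_power)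
  then show "1 - q * q ^ j \<noteq> 0" by auto
qed

lemma qpoch_inf_minus: "qpoch_inf a q * qpoch_inf (- a) q = qpoch_inf (a\<^sup>2) (q\<^sup>2)"
proof -
  have "qpoch_inf a q * qpoch_inf (- a) q = (\<Prod>j. (1 - a * q ^ j) * (1 - (- a) * q ^ j))"
    unfolding qpoch_inf_def by (rule prodinf_mult[OF convergent_qpoch convergent_qpoch])
  also have "(\<lambda>j. (1 - a * q ^ j) * (1 - (- a) * q ^ j)) = (\<lambda>j. 1 - a\<^sup>2 * (q\<^sup>2) ^ j)"
    by (auto simp: algebra_simps power2_eq_square power_mult_distrib)
  finally show ?thesis by (simp add: qpoch_inf_def)
qed

text \<open>The M-test with majorant \<open>R * norm q ^ j\<close> applies; locally uniform limits
  of polynomials are holomorphic, which is the use made of this.\<close>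

lemma uniform_limit_qpoch_fin:
  "uniform_limit (cball 0 R) (\<lambda>n a. qpoch_fin a q n) (\<lambda>a. qpoch_inf a q) sequentially"
proof -
  have "uniformly_convergent_on (cball 0 R) (\<lambda>N a. \<Prod>j<N. 1 - a * q ^ j)"
  proof (rule uniformly_convergent_on_prod')
    show "uniformly_convergent_on (cball 0 R) (\<lambda>N a. \<Sum>j<N. norm (1 - a * q ^ j - 1))"
    proof (rule Weierstrass_m_test')
      show "norm (norm (1 - a * q ^ j - 1)) \<le> R * norm q ^ j" if "a \<in> cball 0 R" for j a
        using that by (simp add: norm_mult norm_power mult_right_mono)
      show "summable (\<lambda>j. R * norm q ^ j)"
        using q1 by (intro summable_mult summable_geometric) auto
    qed
  qed (auto intro!: continuous_intros)
  then obtain l where l: "uniform_limit (cball 0 R) (\<lambda>n a. qpoch_fin a q n) l sequentially"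
    unfolding qpoch_fin_def uniformly_convergent_on_def by blast
  \<comment> \<open>The convergence criterion only provides some uniform limit \<open>l\<close>; the
    pointwise limit identifies it.\<close>
  have "l a = qpoch_inf a q" if "a \<in> cball 0 R" for a
    by (rule LIMSEQ_unique[OF tendsto_uniform_limitI[OF l that] qpoch_fin_tendsto])
  with l show ?thesis
    using uniform_limit_cong'[of "cball 0 R" _ _ l "\<lambda>a. qpoch_inf a q"] by fastforce
qed

lemma qpoch_inf_holomorphic: "(\<lambda>a. qpoch_inf a q) holomorphic_on A"
proof -
  have "(\<lambda>a. qpoch_inf a q) holomorphic_on UNIV"
  proof (rule holomorphic_uniform_sequence)
    show "(\<lambda>a. qpoch_fin a q n) holomorphic_on UNIV" for n
      unfolding qpoch_fin_def by (intro holomorphic_intros)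
    fix z :: complex
    have "uniform_limit (cball z 1) (\<lambda>n a. qpoch_fin a q n) (\<lambda>a. qpoch_inf a q) sequentially"
      by (rule uniform_limit_on_subset[OF uniform_limit_qpoch_fin[of "norm z + 1"]])
         (simp add: cball_subset_cball_iff)
    then show "\<exists>d>0. cball z d \<subseteq> UNIV \<and>
        uniform_limit (cball z d) (\<lambda>n a. qpoch_fin a q n) (\<lambda>a. qpoch_inf a q) sequentially"
      by (intro exI[of _ 1]) auto
  qed auto
  then show ?thesis by (rule holomorphic_on_subset) auto
qed

lemma isCont_qpoch_inf: "isCont (\<lambda>a. qpoch_inf a q) a"
  using holomorphic_on_imp_continuous_on[OF qpoch_inf_holomorphic[of UNIV]]
  by (simp add: continuous_on_eq_continuous_at)

end

section \<open>Theta function, the two bilateral series and their functional equations\<close>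

definition theta :: "complex \<Rightarrow> complex \<Rightarrow> complex" where
  "theta z q = qpoch_inf z q * qpoch_inf (q / z) q"

text \<open>The summand \<open>q^(n^2) / (zq, q/z; q)_n\<close> of the bilateral rank generating
  function, multiplied by \<open>(zq, q/z; q)_inf\<close> to clear denominators.\<close>

definition bterm :: "complex \<Rightarrow> complex \<Rightarrow> int \<Rightarrow> complex" where
  "bterm z q n = q powi (n\<^sup>2) * (qpoch_inf (z * q powi (n + 1)) q * qpoch_inf (q powi (n + 1) / z) q)"

definition hterm :: "complex \<Rightarrow> complex \<Rightarrow> int \<Rightarrow> complex" where
  "hterm z q n = q powi (n\<^sup>2 + n) * (qpoch_inf (z * q powi (n + 1)) q * qpoch_inf (q powi (n + 2) / z) q)"

definition bsum :: "complex \<Rightarrow> complex \<Rightarrow> complex" where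
  "bsum z q = (\<Sum>\<^sub>\<infinity>n\<in>UNIV. bterm z q n)"

definition hsum :: "complex \<Rightarrow> complex \<Rightarrow> complex" where
  "hsum z q = (\<Sum>\<^sub>\<infinity>n\<in>UNIV. hterm z q n)"

lemma norm_four_le:
  fixes a b c d :: complex
  assumes "norm a \<le> exp t" "norm b \<le> exp t" "norm c \<le> exp t" "norm d \<le> exp t" "t \<ge> 0"
  shows "norm (a * b * (c * d)) \<le> exp (4 * t)"
proof -
  have "norm (a * b * (c * d)) = norm a * norm b * (norm c * norm d)" by (simp add: norm_mult)
  also have "\<dots> \<le> exp t * exp t * (exp t * exp t)"
    using assms by (intro mult_mono) auto
  also have "\<dots> = exp (4 * t)" by (simp flip: exp_add)
  finally show ?thesis .
qed

text \<open>The exponent is deliberately generous: the same constant then serves the terms of both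
  halves of the series.\<close>

lemma norm_two_le:
  fixes a b :: complex
  assumes "norm a \<le> exp t" "norm b \<le> exp t" "t \<ge> 0"
  shows "norm (a * b) \<le> exp (4 * t)"
  using norm_four_le[of a t b 1 1] assms by simp

context
  fixes q :: complex
  assumes q1: "norm q < 1" and q0: "q \<noteq> 0"
begin

text \<open>Shifting by \<open>q^(-m)\<close> adds the factors
  \<open>1 - a q^(-k) = - a q^(-k) (1 - q^k / a)\<close> for \<open>k = 1, ..., m\<close>, and
  likewise for \<open>b\<close>. The powers \<open>q^(-k)\<close> of both products multiply to
  \<open>q^(-m(m+1))\<close>, which the prefactor cancels.\<close>

lemma qpoch_inf_pair_shift:
  assumes "a \<noteq> 0" "b \<noteq> 0"
  shows "q powi (int m * (int m + 1)) * (qpoch_inf (a * q powi (- int m)) q * qpoch_inf (b * q powi (- int m)) q)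
    = (a * b) ^ m * (qpoch_fin (q / a) q m * qpoch_fin (q / b) q m) * (qpoch_inf a q * qpoch_inf b q)"
proof (induction m)
  case 0
  then show ?case by (simp add: qpoch_fin_def)
next
  case (Suc m)
  let ?p = "q powi (- int (Suc m))"
  have p: "?p * q = q powi (- int m)" "q powi (- int m) = 1 / q ^ m"
    using q0 by (simp_all add: power_int_diff power_int_minus field_simps)
  have pp: "?p = 1 / q ^ Suc m"
    using q0 by (simp only: power_int_minus power_int_of_nat inverse_eq_divide)
  have e: "int (Suc m) * (int (Suc m) + 1) = int m * (int m + 1) + int (2 * Suc m)"
    by (simp add: algebra_simps)
  have rec: "qpoch_inf (c * ?p) q = (1 - c * ?p) * qpoch_inf (c * q powi (- int m)) q" for c
    using qpoch_inf_rec[OF q1, of "c * ?p"] p by (simp add: mult.assoc)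
  have E: "q powi (int (Suc m) * (int (Suc m) + 1)) = q powi (int m * (int m + 1)) * (q ^ Suc m * q ^ Suc m)"
    unfolding e using q0 by (subst power_int_add) (simp_all only: power_int_of_nat power_add mult_2, simp)
  have fac: "q ^ Suc m * (1 - c * ?p) = - c * (1 - q / c * q ^ m)" if "c \<noteq> 0" for c
    unfolding pp using q0 that by (simp add: field_simps)
  have "q powi (int (Suc m) * (int (Suc m) + 1)) * (qpoch_inf (a * ?p) q * qpoch_inf (b * ?p) q)
      = (q ^ Suc m * (1 - a * ?p)) * (q ^ Suc m * (1 - b * ?p)) *
        (q powi (int m * (int m + 1)) * (qpoch_inf (a * q powi (- int m)) q * qpoch_inf (b * q powi (- int m)) q))"
    unfolding E rec by (simp only: mult_ac)
  also have "\<dots> = (- a * (1 - q / a * q ^ m)) * (- b * (1 - q / b * q ^ m)) *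
     ((a * b) ^ m * (qpoch_fin (q / a) q m * qpoch_fin (q / b) q m) * (qpoch_inf a q * qpoch_inf b q))"
    unfolding fac[OF assms(1)] fac[OF assms(2)] Suc ..
  also have "\<dots> = (a * b) ^ Suc m * (qpoch_fin (q / a) q (Suc m) * qpoch_fin (q / b) q (Suc m)) * (qpoch_inf a q * qpoch_inf b q)"
    by (simp add: qpoch_fin_def mult_ac)
  finally show ?case .
qed

text \<open>Here \<open>a = z q\<close> and \<open>b = q / z\<close>, so
  \<open>(a b)^m = q^(2m)\<close>. The exponent \<open>m^2\<close> falls short of
  \<open>m(m+1)\<close> by \<open>m\<close>, which leaves one factor \<open>q^m\<close>.\<close>

lemma bterm_neg:
  assumes "z \<noteq> 0"
  shows "bterm z q (- int m) = q ^ m * (qpoch_fin (1 / z) q m * qpoch_fin z q m) * (qpoch_inf (z * q) q * qpoch_inf (q / z) q)"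
proof -
  have *: "q powi ((- int m)\<^sup>2) = q powi (int m * (int m + 1)) / q ^ m"
    using q0 by (simp add: power2_eq_square distrib_left power_int_add)
  have **: "q powi (- int m + 1) = q * q powi (- int m)"
    using q0 by (subst power_int_add) (simp_all add: mult.commute)
  have "bterm z q (- int m) * q ^ m = q powi (int m * (int m + 1)) *
      (qpoch_inf (z * q * q powi (- int m)) q * qpoch_inf (q / z * q powi (- int m)) q)"
    unfolding bterm_def * ** using q0 by (simp add: mult.assoc)
  also have "\<dots> = (q * q) ^ m * (qpoch_fin (1 / z) q m * qpoch_fin z q m) * (qpoch_inf (z * q) q * qpoch_inf (q / z) q)"
    using assms q0 by (subst qpoch_inf_pair_shift) simp_all
  also have "\<dots> = (q ^ m * (qpoch_fin (1 / z) q m * qpoch_fin z q m) * (qpoch_inf (z * q) q * qpoch_inf (q / z) q)) * q ^ m"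
    by (simp add: power_mult_distrib)
  finally show ?thesis using q0 by simp
qed

text \<open>At \<open>n = - m - 1\<close> the exponent \<open>n^2 + n\<close> is exactly
  \<open>m(m+1)\<close>; with \<open>a = z\<close> and \<open>b = q / z\<close> the decay comes from
  \<open>(a b)^m = q^m\<close>.\<close>

lemma hterm_neg:
  assumes "z \<noteq> 0"
  shows "hterm z q (- int m - 1) = q ^ m * (qpoch_fin (q / z) q m * qpoch_fin z q m) * (qpoch_inf z q * qpoch_inf (q / z) q)"
proof -
  have e: "(- int m - 1)\<^sup>2 + (- int m - 1) = int m * (int m + 1)" "- int m - 1 + 1 = - int m" "- int m - 1 + 2 = 1 + - int m"
    by (simp_all add: power2_eq_square algebra_simps)
  have **: "q powi (1 + - int m) = q * q powi (- int m)"
    using q0 by (subst power_int_add) simp_all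
  have "hterm z q (- int m - 1) = q powi (int m * (int m + 1)) *
      (qpoch_inf (z * q powi (- int m)) q * qpoch_inf (q / z * q powi (- int m)) q)"
    unfolding hterm_def e ** by simp
  also have "\<dots> = q ^ m * (qpoch_fin (q / z) q m * qpoch_fin z q m) * (qpoch_inf z q * qpoch_inf (q / z) q)"
    using assms q0 by (subst qpoch_inf_pair_shift) simp_all
  finally show ?thesis .
qed

lemma norm_qpow_le:
  fixes a :: complex
  shows "norm (a * q ^ k) \<le> norm a"
  using q1 by (simp add: norm_mult norm_power mult_left_le power_le_one)

text \<open>The dependence on \<open>z\<close> is only through \<open>K\<close>, so the majorants
  are uniform on closed annuli around 0. They give summability as well as holomorphy.\<close>

lemma term_bounds:
  assumes z: "z \<noteq> 0" and K: "norm z \<le> K" "norm (1 / z) \<le> K"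
  shows norm_bterm_nonneg: "norm (bterm z q (int n)) \<le> exp (4 * (K / (1 - norm q))) * norm q ^ n"
    and norm_bterm_neg: "norm (bterm z q (- int n - 1)) \<le> exp (4 * (K / (1 - norm q))) * norm q ^ n"
    and norm_hterm_nonneg: "norm (hterm z q (int n)) \<le> exp (4 * (K / (1 - norm q))) * norm q ^ n"
    and norm_hterm_neg: "norm (hterm z q (- int n - 1)) \<le> exp (4 * (K / (1 - norm q))) * norm q ^ n"
proof -
  let ?t = "K / (1 - norm q)"
  have t: "?t \<ge> 0" using q1 K(1) order.trans[OF norm_ge_zero K(1)] by simp
  have z1: "norm (z * q ^ k) \<le> K" for k using norm_qpow_le K order.trans by blast
  have z2: "norm (1 / z * q ^ k) \<le> K" for k using norm_qpow_le K order.trans by blast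
  have z2': "norm (q ^ k / z) \<le> K" for k using z2[of k] by simp
  note f = norm_qpoch_inf_le[OF q1] norm_qpoch_fin_le[OF q1]
  have e: "q powi (int n + 1) = q ^ (n + 1)" "q powi (int n + 2) = q ^ (n + 2)"
    "q powi ((int n)\<^sup>2) = q ^ n\<^sup>2" "q powi ((int n)\<^sup>2 + int n) = q ^ (n\<^sup>2 + n)"
    using power_int_of_nat[of q "n + 1"] power_int_of_nat[of q "n + 2"] power_int_of_nat[of q "n\<^sup>2"]
      power_int_of_nat[of q "n\<^sup>2 + n"]
    by (simp_all only: of_nat_add of_nat_power of_nat_1 of_nat_numeral)
  have qn: "norm (q ^ k) \<le> norm q ^ n" if "k \<ge> n" for k
    using q1 that by (simp add: norm_power power_decreasing)
  have comb: "norm (c * d) \<le> exp (4 * ?t) * norm q ^ n"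
    if "norm c \<le> norm q ^ n" "norm d \<le> exp (4 * ?t)" for c d :: complex
    unfolding norm_mult using mult_mono[OF that] by (simp add: mult.commute)
  have "norm (qpoch_inf (z * q ^ (n + 1)) q * qpoch_inf (q ^ (n + 1) / z) q) \<le> exp (4 * ?t)"
    by (intro norm_two_le f z1 z2' t)
  moreover have "n \<le> n\<^sup>2" by (simp add: power2_nat_le_imp_le power2_eq_square)
  ultimately show "norm (bterm z q (int n)) \<le> exp (4 * ?t) * norm q ^ n"
    unfolding bterm_def e by (intro comb qn)
  have "norm (qpoch_inf (z * q ^ (n + 1)) q * qpoch_inf (q ^ (n + 2) / z) q) \<le> exp (4 * ?t)"
    by (intro norm_two_le f z1 z2' t)
  then show "norm (hterm z q (int n)) \<le> exp (4 * ?t) * norm q ^ n"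
    unfolding hterm_def e by (intro comb qn) simp_all
  have n: "norm (qpoch_inf z q) \<le> exp ?t" "norm (qpoch_inf (z * q) q) \<le> exp ?t" "norm (qpoch_inf (q / z) q) \<le> exp ?t"
    "norm (qpoch_fin z q k) \<le> exp ?t" "norm (qpoch_fin (1 / z) q k) \<le> exp ?t" "norm (qpoch_fin (q / z) q k) \<le> exp ?t" for k
    using f[OF z1[of 0]] f[OF z1[of 1]] f[OF z2'[of 0]] f[OF z2'[of 1]] by simp_all
  have "- int n - 1 = - int (Suc n)" by simp
  then have "bterm z q (- int n - 1) = q ^ Suc n * ((qpoch_fin (1 / z) q (Suc n) * qpoch_fin z q (Suc n)) * (qpoch_inf (z * q) q * qpoch_inf (q / z) q))"
    using bterm_neg[OF z, of "Suc n"] by (simp only: mult.assoc)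
  then show "norm (bterm z q (- int n - 1)) \<le> exp (4 * ?t) * norm q ^ n"
    by (simp only:) (intro comb qn norm_four_le n t, simp)
  show "norm (hterm z q (- int n - 1)) \<le> exp (4 * ?t) * norm q ^ n"
    unfolding hterm_neg[OF z] mult.assoc[of "q ^ n"] by (intro comb qn norm_four_le n t) simp
qed

lemma
  assumes z: "z \<noteq> 0"
  shows bterm_summable: "bterm z q summable_on UNIV"
    and bsum_eq: "bsum z q = (\<Sum>n. bterm z q (int n)) + (\<Sum>n. bterm z q (- int n - 1))"
    and hterm_summable: "hterm z q summable_on UNIV"
proof -
  have K: "norm z \<le> max (norm z) (norm (1 / z))" "norm (1 / z) \<le> max (norm z) (norm (1 / z))" by simp_all
  note * = norm_ge_zero q1 term_bounds[OF z K]
  show "bterm z q summable_on UNIV" by (rule bilateral_summable(1)[OF *(1-4)])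
  show "bsum z q = (\<Sum>n. bterm z q (int n)) + (\<Sum>n. bterm z q (- int n - 1))"
    unfolding bsum_def by (rule bilateral_summable(2)[OF *(1-4)])
  show "hterm z q summable_on UNIV" by (rule bilateral_summable(1)[OF *(1,2,5,6)])
qed

text \<open>Both values are \<open>(1/z, zq; q)_inf\<close>; peeling off the factor
  \<open>1 - 1/z\<close> and restoring \<open>1 - z\<close> produces the multiplier
  \<open>-1/z\<close>.\<close>

lemma theta_inverse:
  assumes "z \<noteq> 0"
  shows "theta (1 / z) q = - theta z q / z" "theta (z * q) q = - theta z q / z"
proof -
  have a: "qpoch_inf (1 / z) q = (1 - 1 / z) * qpoch_inf (q / z) q"
    using qpoch_inf_rec[OF q1, of "1 / z"] by simp
  have b: "qpoch_inf z q = (1 - z) * qpoch_inf (z * q) q"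
    by (rule qpoch_inf_rec[OF q1])
  show "theta (1 / z) q = - theta z q / z"
    unfolding theta_def b a using assms by (simp add: field_simps)
  show "theta (z * q) q = - theta z q / z"
  proof -
    have "theta (z * q) q = qpoch_inf (z * q) q * qpoch_inf (1 / z) q"
      using q0 by (simp add: theta_def)
    then show ?thesis
      unfolding theta_def b a using assms by (simp add: field_simps)
  qed
qed

text \<open>With \<open>u\<^sub>n\<close> the summand of \<open>bsum\<close> times \<open>q ^ n\<close>, the summand of \<open>hsum\<close> is
  \<open>bterm z q (n + 1) / z + u\<^sub>n - u\<^sub>n\<^sub>+\<^sub>1\<close>; the limit of \<open>u\<close> at minus infinity gives the theta term.\<close>

lemma hsum_bsum:
  assumes z: "z \<noteq> 0"
  shows "z * hsum z q = bsum z q - (theta z q)\<^sup>2"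
proof -
  define u where "u n = q powi n * bterm z q n" for n
  have tele: "hterm z q n - bterm z q (n + 1) / z = u n - u (n + 1)" for n
  proof -
    let ?p = "q powi (n + 1)"
    let ?f = "\<lambda>a. qpoch_inf a q"
    have pq: "?p * q = q powi (n + 2)"
      using power_int_add_1[of q "n + 1"] q0 by (simp add: add.assoc)
    have 1: "?f (z * ?p) = (1 - z * ?p) * ?f (z * q powi (n + 2))"
      using qpoch_inf_rec[OF q1, of "z * ?p"] pq by (simp add: mult.assoc)
    have 2: "?f (?p / z) = (1 - ?p / z) * ?f (q powi (n + 2) / z)"
      using qpoch_inf_rec[OF q1, of "?p / z"] pq by simp
    have e: "q powi ((n + 1)\<^sup>2) = q powi (n\<^sup>2 + n) * ?p"
      using q0 by (simp add: power2_eq_square algebra_simps flip: power_int_add)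
    have e': "q powi n * q powi (n\<^sup>2) = q powi (n\<^sup>2 + n)"
      using q0 by (simp add: power_int_add)
    have n2: "n + 1 + 1 = n + 2" by simp
    have u: "u n = q powi (n\<^sup>2 + n) * ((1 - z * ?p) * ?f (z * q powi (n + 2)) * ((1 - ?p / z) * ?f (q powi (n + 2) / z)))"
      unfolding u_def bterm_def 1 2 mult.assoc[symmetric] e' ..
    show ?thesis
      unfolding u unfolding u_def bterm_def hterm_def n2 e 1 using z by (simp add: field_simps)
  qed
  have b1: "((\<lambda>n. bterm z q (n + 1)) has_sum bsum z q) UNIV"
  proof -
    have "(bterm z q has_sum bsum z q) UNIV"
      unfolding bsum_def using bterm_summable[OF z] by (rule has_sum_infsum)
    moreover have "bij_betw (\<lambda>n::int. n + 1) UNIV UNIV"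
      by (rule bij_betwI[of _ _ _ "\<lambda>n. n - 1"]) auto
    ultimately show ?thesis
      using has_sum_reindex_bij_betw[of "\<lambda>n::int. n + 1" UNIV UNIV "bterm z q" "bsum z q"] by simp
  qed
  have h1: "(hterm z q has_sum hsum z q) UNIV"
    unfolding hsum_def using hterm_summable[OF z] by (rule has_sum_infsum)
  have "((\<lambda>n. hterm z q n - bterm z q (n + 1) / z) has_sum (hsum z q - bsum z q / z)) UNIV"
    using has_sum_add[OF h1 has_sum_uminusI[OF has_sum_divide_const[OF b1, of z]]] by simp
  then have "((\<lambda>n. u n - u (n + 1)) has_sum (hsum z q - bsum z q / z)) UNIV"
    by (simp only: tele)
  then have "hsum z q - bsum z q / z = theta (1 / z) q * theta z q"
  proof (rule has_sum_telescope_int)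
    have K: "norm z \<le> max (norm z) (norm (1 / z))" "norm (1 / z) \<le> max (norm z) (norm (1 / z))" by simp_all
    define C where "C = exp (4 * (max (norm z) (norm (1 / z)) / (1 - norm q)))"
    have bound: "norm (u (int n)) \<le> C * norm q ^ n" for n
    proof -
      have "norm (u (int n)) = norm q ^ n * norm (bterm z q (int n))"
        by (simp add: u_def norm_mult norm_power)
      also have "\<dots> \<le> 1 * (C * norm q ^ n)"
        using norm_bterm_nonneg[OF z K] q1 by (intro mult_mono power_le_one) (auto simp: C_def)
      finally show ?thesis by simp
    qed
    have lim: "(\<lambda>n. C * norm q ^ n) \<longlonglongrightarrow> 0"
      by (rule tendsto_mult_right_zero[OF LIMSEQ_power_zero]) (simp add: q1)
    show "(\<lambda>n. u (int n)) \<longlonglongrightarrow> 0"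
      by (rule Lim_null_comparison[OF always_eventually lim]) (simp add: bound)
    \<comment> \<open>The weight \<open>q^(-m)\<close> cancels the decay \<open>q^m\<close> in
      \<open>bterm_neg\<close>, so only convergent finite products remain.\<close>
    have "u (- int m) = (qpoch_fin (1 / z) q m * qpoch_fin z q m) * (qpoch_inf (z * q) q * qpoch_inf (q / z) q)" for m
    proof -
      have "q powi (- int m) * q ^ m = 1"
        using q0 by (simp add: power_int_minus)
      then show ?thesis
        unfolding u_def bterm_neg[OF z] by (simp flip: mult.assoc)
    qed
    moreover have "(\<lambda>m. (qpoch_fin (1 / z) q m * qpoch_fin z q m) * (qpoch_inf (z * q) q * qpoch_inf (q / z) q))
      \<longlonglongrightarrow> (qpoch_inf (1 / z) q * qpoch_inf z q) * (qpoch_inf (z * q) q * qpoch_inf (q / z) q)"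
      by (intro tendsto_mult qpoch_fin_tendsto q1 tendsto_const)
    ultimately show "(\<lambda>m. u (- int m)) \<longlonglongrightarrow> theta (1 / z) q * theta z q"
      by (simp add: theta_def mult_ac)
  qed
  then have e: "hsum z q = (bsum z q - (theta z q)\<^sup>2) / z"
    unfolding theta_inverse(1)[OF z] by (simp add: diff_divide_distrib diff_eq_eq power2_eq_square)
  show ?thesis unfolding e using z by simp
qed

lemma bsum_inverse: "bsum (1 / z) q = bsum z q"
  unfolding bsum_def bterm_def by (simp add: mult.commute)

text \<open>This is the symmetry \<open>w \<mapsto> q / w\<close> at \<open>w = z q\<close>: it
  exchanges the two products in each summand.\<close>

lemma hsum_inverse:
  assumes "z \<noteq> 0"
  shows "hsum (z * q) q = hsum (1 / z) q"
proof -
  have "hterm (z * q) q n = hterm (1 / z) q n" for n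
  proof -
    have "q powi (n + 2) = q * q powi (n + 1)"
      using q0 power_int_add_1[of q "n + 1"] by (simp add: add.assoc mult.commute)
    then show ?thesis unfolding hterm_def using q0 by (simp add: mult_ac)
  qed
  then show ?thesis by (simp add: hsum_def)
qed

text \<open>\<open>hsum_bsum\<close> is applied at \<open>1 / z\<close> and at \<open>z q\<close>.
  There the values of \<open>hsum\<close> agree, and so do the squared thetas; eliminating
  \<open>hsum\<close> relates the two values of \<open>bsum\<close>.\<close>

lemma bsum_shift:
  assumes z: "z \<noteq> 0"
  shows "bsum (z * q) q = q * z\<^sup>2 * bsum z q + (1 / z\<^sup>2 - q) * (theta z q)\<^sup>2"
proof -
  have "1 / z * hsum (1 / z) q = bsum z q - (theta z q / z)\<^sup>2"
    using hsum_bsum[of "1 / z"] z by (simp add: bsum_inverse theta_inverse)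
  moreover have "z * q * hsum (1 / z) q = bsum (z * q) q - (theta z q / z)\<^sup>2"
    using hsum_bsum[of "z * q"] z q0 hsum_inverse[OF z] by (simp add: theta_inverse)
  moreover have "z * q * h = z\<^sup>2 * q * (1 / z * h)" for h
    using z by (simp add: power2_eq_square)
  ultimately have "bsum (z * q) q = z\<^sup>2 * q * (bsum z q - (theta z q / z)\<^sup>2) + (theta z q / z)\<^sup>2"
    by (metis diff_add_cancel)
  then show ?thesis using z by (simp add: field_simps power2_eq_square)
qed

end

section \<open>Constancy of q-periodic functions and holomorphy of the series\<close>

text \<open>Every orbit under multiplication by \<open>q\<close> meets the compact annulus
  \<open>norm q \<le> norm w \<le> 1\<close>, so \<open>F\<close> is bounded. Composing with
  \<open>exp\<close> removes the puncture and gives a bounded entire function.\<close>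

lemma holomorphic_q_periodic_const:
  fixes F :: "complex \<Rightarrow> complex"
  assumes q1: "norm q < 1" and q0: "q \<noteq> 0"
    and holo: "F holomorphic_on - {0}"
    and per: "\<And>z. z \<noteq> 0 \<Longrightarrow> F (z * q) = F z"
    and z: "z \<noteq> 0"
  shows "F z = F 1"
proof -
  have per_int: "F (w * q powi k) = F w" if "w \<noteq> 0" for w and k :: int
  proof (induction k rule: int_induct[where k = 0])
    case (step1 i)
    then show ?case using per[of "w * q powi i"] q0 that by (simp add: power_int_add_1 mult.assoc)
  next
    case (step2 i)
    have "q powi (i - 1) * q = q powi i" using q0 by (simp add: power_int_diff)
    then show ?case using step2 per[of "w * q powi (i - 1)"] q0 that by (simp add: mult.assoc)
  qed simp
  let ?A = "cball 0 1 - ball 0 (norm q) :: complex set"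
  have "compact ?A" by (intro compact_diff) auto
  moreover have "?A \<subseteq> - {0}" using q0 by auto
  then have "continuous_on ?A F"
    using holomorphic_on_imp_continuous_on[OF holo] continuous_on_subset by blast
  ultimately have bdd: "bounded (F ` ?A)"
    by (intro compact_imp_bounded compact_continuous_image)
  have "F w \<in> F ` ?A" if w: "w \<noteq> 0" for w
  proof -
    define L where "L = - ln (norm q)"
    have L: "L > 0" using q1 q0 by (simp add: L_def)
    \<comment> \<open>This choice puts \<open>ln (norm w) - L * k\<close> into the interval from
      \<open>- L\<close> (excluded) to 0, that is, \<open>w * q powi k\<close> into the
      annulus.\<close>
    define k where "k = \<lceil>ln (norm w) / L\<rceil>"
    have "norm (q powi k) = exp (- L * k)"
      using q0 by (simp add: norm_power_int L_def powr_def flip: powr_real_of_int')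
    then have n: "norm (w * q powi k) = exp (ln (norm w) - L * k)"
      using w by (simp add: norm_mult exp_diff exp_minus field_simps)
    have "ln (norm w) / L \<le> k" "k < ln (norm w) / L + 1"
      by (simp_all add: k_def) linarith
    then have "ln (norm w) - L * k \<le> 0" "ln (norm w) - L * k \<ge> ln (norm q)"
      using L by (simp_all add: field_simps L_def)
    then have "norm (w * q powi k) \<le> 1" "norm (w * q powi k) \<ge> norm q"
      unfolding n using q0 exp_le_cancel_iff[of "ln (norm q)"] by simp_all
    then have "w * q powi k \<in> ?A" by simp
    then show ?thesis using per_int[OF w, of k] by (metis image_eqI)
  qed
  then have "range (\<lambda>w. F (exp w)) \<subseteq> F ` ?A" by auto
  then have "bounded (range (\<lambda>w. F (exp w)))" using bdd bounded_subset by blast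
  moreover have "range exp \<subseteq> - {0 :: complex}" by auto
  then have "(\<lambda>w. F (exp w)) holomorphic_on UNIV"
    using holomorphic_on_compose_gen[OF holomorphic_on_exp holo] by (simp only: o_def)
  ultimately obtain c where c: "\<And>w. F (exp w) = c"
    using Liouville_theorem[of "\<lambda>w. F (exp w)"] by (auto simp: constant_on_def)
  show ?thesis using c[of "Ln z"] c[of 0] z by simp
qed

context
  fixes q :: complex
  assumes q1: "norm q < 1" and q0: "q \<noteq> 0"
begin

lemma qpoch_inf_holomorphic_compose:
  assumes "g holomorphic_on A"
  shows "(\<lambda>z. qpoch_inf (g z) q) holomorphic_on A"
  using holomorphic_on_compose[OF assms qpoch_inf_holomorphic[OF q1]] by (simp add: o_def)

lemma theta_holomorphic: "(\<lambda>z. theta z q) holomorphic_on - {0}"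
  unfolding theta_def by (intro holomorphic_intros qpoch_inf_holomorphic_compose) auto

text \<open>The index map \<open>i\<close> is left open so that one argument covers the nonnegative
  and the negative half of \<open>bsum\<close>.\<close>

lemma bterm_series_holomorphic:
  fixes i :: "nat \<Rightarrow> int"
  assumes bound: "\<And>z K n. z \<noteq> 0 \<Longrightarrow> norm z \<le> K \<Longrightarrow> norm (1 / z) \<le> K \<Longrightarrow>
    norm (bterm z q (i n)) \<le> exp (4 * (K / (1 - norm q))) * norm q ^ n"
  shows "(\<lambda>z. \<Sum>n. bterm z q (i n)) holomorphic_on - {0}"
proof -
  have "(\<lambda>z. bterm z q n) holomorphic_on - {0}" for n
    unfolding bterm_def by (intro holomorphic_intros qpoch_inf_holomorphic_compose) auto
  then have diff: "(\<lambda>z. bterm z q (i n)) field_differentiable (at x)" if "x \<in> - {0}" for n x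
    using that holomorphic_on_imp_differentiable_at by (metis open_Compl closed_singleton)
  have comp: "\<exists>d h. 0 < d \<and> summable h \<and> range h \<subseteq> \<real>\<^sub>\<ge>\<^sub>0 \<and>
    (\<forall>\<^sub>F n in sequentially. \<forall>y\<in>ball x d \<inter> - {0}. norm (bterm y q (i n)) \<le> norm (h n :: complex))"
    if x: "x \<in> - {0}" for x
  proof (intro exI conjI)
    \<comment> \<open>On the ball of radius \<open>norm x / 2\<close> around \<open>x\<close>,
      \<open>norm y\<close> lies between \<open>norm x / 2\<close> and
      \<open>3 / 2 * norm x\<close>; \<open>?K\<close> therefore bounds both \<open>norm y\<close>
      and \<open>norm (1 / y)\<close>.\<close>
    let ?K = "max (3 / 2 * norm x) (2 / norm x)"
    let ?h = "\<lambda>n. complex_of_real (exp (4 * (?K / (1 - norm q))) * norm q ^ n)"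
    show "0 < norm x / 2" using x by simp
    show "summable ?h"
      unfolding summable_of_real_iff using q1 by (intro summable_mult summable_geometric) auto
    show "range ?h \<subseteq> \<real>\<^sub>\<ge>\<^sub>0" by auto
    show "\<forall>\<^sub>F n in sequentially. \<forall>y\<in>ball x (norm x / 2) \<inter> - {0}. norm (bterm y q (i n)) \<le> norm (?h n)"
    proof (intro always_eventually allI ballI)
      fix n y assume y: "y \<in> ball x (norm x / 2) \<inter> - {0}"
      then have "norm (x - y) < norm x / 2" by (simp add: dist_norm)
      then have "norm y \<le> 3 / 2 * norm x" "norm y \<ge> norm x / 2"
        using norm_triangle_ineq2[of x y] norm_triangle_ineq3[of x y] by linarith+
      moreover from this have "1 / norm y \<le> 2 / norm x"
        using x y by (simp add: field_simps)
      ultimately have "norm (bterm y q (i n)) \<le> exp (4 * (?K / (1 - norm q))) * norm q ^ n"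
        using y by (intro bound) (auto simp: norm_divide)
      then show "norm (bterm y q (i n)) \<le> norm (?h n)"
        by (simp add: norm_mult norm_power)
    qed
  qed
  obtain g where g: "\<forall>x \<in> - {0}. ((\<lambda>n. bterm x q (i n)) sums g x) \<and> g field_differentiable (at x)"
    by (rule series_differentiable_comparison_complex[of "- {0}" "\<lambda>n z. bterm z q (i n)", OF _ diff comp]) auto
  then have "g holomorphic_on - {0}"
    by (auto simp: holomorphic_on_def field_differentiable_at_within)
  moreover have "g x = (\<Sum>n. bterm x q (i n))" if "x \<in> - {0}" for x
    using g that by (auto simp: sums_iff)
  ultimately show ?thesis by (rule holomorphic_transform)
qed

lemma bsum_holomorphic: "(\<lambda>z. bsum z q) holomorphic_on - {0}"
proof -
  have "(\<lambda>z. (\<Sum>n. bterm z q (int n)) + (\<Sum>n. bterm z q (- int n - 1))) holomorphic_on - {0}"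
    using norm_bterm_nonneg[OF q1 q0] norm_bterm_neg[OF q1 q0]
    by (intro holomorphic_on_add bterm_series_holomorphic)
  then show ?thesis
    by (rule holomorphic_transform) (simp add: bsum_eq[OF q1 q0])
qed

section \<open>Durfee's identity\<close>

text \<open>The summand of Cauchy's identity, the sum of
  \<open>q^(n^2) t^n / ((q; q)_n (tq; q)_n)\<close> being \<open>1 / (tq; q)_inf\<close>, multiplied
  by \<open>(q, tq; q)_inf\<close>.\<close>

definition durfee :: "complex \<Rightarrow> nat \<Rightarrow> complex" where
  "durfee t n = q ^ (n\<^sup>2) * t ^ n * (qpoch_inf (q ^ Suc n) q * qpoch_inf (t * q ^ Suc n) q)"

lemma square_le: "n \<le> n\<^sup>2" for n :: nat
  by (simp add: power2_eq_square)

text \<open>Free exponents \<open>k\<close> and \<open>l\<close> let the bound cover both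
  \<open>durfee\<close> and the telescoping certificate in \<open>durfee_shift\<close>.\<close>

lemma norm_power_square_le:
  assumes t: "norm t \<le> 1"
  shows "norm (q ^ (n\<^sup>2) * t ^ n * (qpoch_inf (q ^ k) q * qpoch_inf (t * q ^ l) q))
    \<le> exp (4 * (1 / (1 - norm q))) * norm q ^ n"
proof -
  have "norm (q ^ k) \<le> 1" using q1 by (simp add: norm_power power_le_one)
  moreover have "norm (t * q ^ l) \<le> 1" using q1 t by (simp add: norm_mult norm_power power_le_one mult_le_one)
  ultimately have "norm (qpoch_inf (q ^ k) q * qpoch_inf (t * q ^ l) q) \<le> exp (4 * (1 / (1 - norm q)))"
    using q1 by (intro norm_two_le norm_qpoch_inf_le) simp_all
  moreover have "norm (q ^ (n\<^sup>2) * t ^ n) \<le> norm q ^ n * 1"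
    unfolding norm_mult norm_power using q1 t square_le[of n]
    by (intro mult_mono power_decreasing power_le_one) auto
  ultimately have "norm (q ^ (n\<^sup>2) * t ^ n) * norm (qpoch_inf (q ^ k) q * qpoch_inf (t * q ^ l) q)
      \<le> (norm q ^ n * 1) * exp (4 * (1 / (1 - norm q)))"
    by (intro mult_mono) simp_all
  then show ?thesis by (simp only: norm_mult mult_1_right mult.commute)
qed

lemma norm_durfee_le:
  assumes "norm t \<le> 1"
  shows "norm (durfee t n) \<le> exp (4 * (1 / (1 - norm q))) * norm q ^ n"
  unfolding durfee_def by (rule norm_power_square_le[OF assms])

lemma durfee_majorant_summable: "summable (\<lambda>n. exp (4 * (1 / (1 - norm q))) * norm q ^ n)"
  using q1 by (intro summable_mult summable_geometric) auto

lemma durfee_summable: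
  assumes "norm t \<le> 1"
  shows "summable (durfee t)"
  by (rule summable_comparison_test'[OF durfee_majorant_summable norm_durfee_le[OF assms]])

text \<open>The certificate \<open>G\<close> makes the difference of the two series telescope, so \<open>suminf (durfee t)\<close> does
  not depend on \<open>t\<close> along \<open>q ^ N\<close> and can be evaluated in the limit \<open>t = 0\<close>.\<close>

lemma durfee_shift:
  assumes t: "norm t \<le> 1"
  shows "suminf (durfee (t * q)) = suminf (durfee t)"
proof -
  define G where "G n = - (q ^ (n\<^sup>2) * t ^ n * (qpoch_inf (q ^ n) q * qpoch_inf (t * q ^ Suc n) q))" for n
  have tq: "norm (t * q) \<le> 1" using t q1 by (simp add: norm_mult mult_le_one)
  have diff: "durfee t n - durfee (t * q) n = G (Suc n) - G n" for n
  proof -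
    have 1: "qpoch_inf (q ^ n) q = (1 - q ^ n) * qpoch_inf (q ^ Suc n) q"
      using qpoch_inf_rec[OF q1, of "q ^ n"] by (simp add: mult.commute)
    have 2: "qpoch_inf (t * q ^ Suc n) q = (1 - t * q ^ Suc n) * qpoch_inf (t * q ^ Suc (Suc n)) q"
      using qpoch_inf_rec[OF q1, of "t * q ^ Suc n"] by (simp add: mult_ac)
    have 3: "t * q * q ^ Suc n = t * q ^ Suc (Suc n)" by simp
    have 4: "q ^ ((Suc n)\<^sup>2) = q ^ (n\<^sup>2) * q ^ n * q ^ n * q"
      by (simp add: power2_eq_square power_add)
    show ?thesis
      unfolding durfee_def G_def 1 2 3 4 power_mult_distrib by (simp add: algebra_simps)
  qed
  have bound: "norm (G n) \<le> exp (4 * (1 / (1 - norm q))) * norm q ^ n" for n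
    unfolding G_def norm_minus_cancel by (rule norm_power_square_le[OF t])
  have "G \<longlonglongrightarrow> 0"
    by (rule Lim_null_comparison[OF always_eventually summable_LIMSEQ_zero[OF durfee_majorant_summable]])
       (rule allI, rule bound)
  then have "(\<lambda>n. G (Suc n) - G n) sums (0 - G 0)"
    by (rule telescope_sums)
  \<comment> \<open>The lower boundary term contains \<open>(1; q)_inf = 0\<close>.\<close>
  moreover have "G 0 = 0" by (simp add: G_def qpoch_inf_1[OF q1])
  ultimately have "(\<lambda>n. durfee t n - durfee (t * q) n) sums 0"
    by (simp add: diff)
  moreover have "(\<lambda>n. durfee t n - durfee (t * q) n) sums (suminf (durfee t) - suminf (durfee (t * q)))"
    by (intro sums_diff summable_sums durfee_summable t tq)
  ultimately show ?thesis using sums_unique2 by fastforce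
qed

lemma durfee_square: "suminf (durfee 1) = qpoch_inf q q"
proof -
  have qN: "norm (q ^ N) \<le> 1" for N using q1 by (simp add: norm_power power_le_one)
  have const: "suminf (durfee (q ^ N)) = suminf (durfee 1)" for N
    by (induction N) (use durfee_shift[OF qN] in \<open>simp_all add: mult.commute\<close>)
  have qN0: "(\<lambda>N. q ^ N) \<longlonglongrightarrow> 0" using q1 by (rule LIMSEQ_power_zero)
  have lim: "(\<lambda>N. durfee (q ^ N) n) \<longlonglongrightarrow> durfee 0 n" for n
    unfolding durfee_def
    by (intro tendsto_intros qN0 isCont_tendsto_compose[OF isCont_qpoch_inf[OF q1]])
  have "\<forall>\<^sub>F (n, N) in sequentially \<times>\<^sub>F sequentially.
      norm (durfee (q ^ N) n) \<le> exp (4 * (1 / (1 - norm q))) * norm q ^ n"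
    using norm_durfee_le[OF qN] by (auto intro!: always_eventually)
  \<comment> \<open>The majorant is independent of \<open>N\<close>, so limit and sum may be
    interchanged.\<close>
  from tannerys_theorem[OF lim this durfee_majorant_summable]
  have "(\<lambda>N. suminf (durfee (q ^ N))) \<longlonglongrightarrow> suminf (durfee 0)" by simp
  then have "suminf (durfee 1) = suminf (durfee 0)"
    unfolding const by (simp add: LIMSEQ_const_iff)
  \<comment> \<open>At \<open>t = 0\<close> the factor \<open>t ^ n\<close> kills every term but
    \<open>n = 0\<close>, where \<open>0 ^ 0 = 1\<close>.\<close>
  also have "\<dots> = (\<Sum>n\<in>{0}. durfee 0 n)"
    by (rule suminf_finite) (auto simp: durfee_def)
  finally show ?thesis by (simp add: durfee_def qpoch_inf_0[OF q1])
qed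

text \<open>At \<open>z = 1\<close> every negative index contributes a finite product containing
  \<open>1 - 1\<close>; the other half is the Durfee series.\<close>

lemma bsum_1: "bsum 1 q = qpoch_inf q q"
proof -
  have "bterm 1 q (- int n - 1) = 0" for n
  proof -
    have "bterm 1 q (- int (Suc n)) = 0"
      unfolding bterm_neg[OF q1 q0 one_neq_zero] by (simp add: qpoch_fin_rec[OF q1])
    moreover have "- int n - 1 = - int (Suc n)" by simp
    ultimately show ?thesis by (simp only:)
  qed
  moreover have "bterm 1 q (int n) = durfee 1 n" for n
  proof -
    have "q powi (int n + 1) = q ^ Suc n" "q powi ((int n)\<^sup>2) = q ^ (n\<^sup>2)"
      using power_int_of_nat[of q "Suc n"] power_int_of_nat[of q "n\<^sup>2"]
      by (simp_all only: of_nat_Suc of_nat_power add.commute)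
    then show ?thesis by (simp add: bterm_def durfee_def)
  qed
  ultimately show ?thesis
    using bsum_eq[OF q1 q0, of 1] durfee_square by simp
qed

section \<open>Evaluation of the constant and return to \<open>g3c\<close>\<close>

text \<open>Under \<open>w \<mapsto> w q\<close> the inhomogeneous terms of
  \<open>bsum_shift\<close> cancel, their coefficient \<open>1 / w^2 - q\<close> being even in
  \<open>w\<close>. The remaining multipliers are \<open>q w^2\<close> from \<open>bsum\<close>,
  \<open>1 / w^2\<close> from the squared thetas and \<open>1 / q\<close> from the denominator, with
  product 1.\<close>

lemma theta_bsum_identity:
  assumes z: "z \<noteq> 0"
  shows "(theta (- z) q)\<^sup>2 * bsum z q - (theta z q)\<^sup>2 * bsum (- z) q
    = 4 * z * qpoch_inf (- q) q ^ 4 * qpoch_inf q q"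
proof -
  define E where "E w = ((theta (- w) q)\<^sup>2 * bsum w q - (theta w q)\<^sup>2 * bsum (- w) q) / w" for w
  have uminus: "(\<lambda>w. f (- w)) holomorphic_on - {0}" if "f holomorphic_on - {0}" for f :: "complex \<Rightarrow> complex"
  proof -
    have "uminus ` (- {0}) \<subseteq> - {0 :: complex}" by auto
    then show ?thesis
      using holomorphic_on_compose_gen[OF holomorphic_on_minus[OF holomorphic_on_ident] that] by (simp only: o_def)
  qed
  have "E holomorphic_on - {0}"
    unfolding E_def
    by (intro holomorphic_intros theta_holomorphic bsum_holomorphic uminus[of "\<lambda>w. theta w q"]
        uminus[of "\<lambda>w. bsum w q"]) auto
  moreover have "E (w * q) = E w" if w: "w \<noteq> 0" for w
  proof -
    have *: "bsum (- (w * q)) q = q * w\<^sup>2 * bsum (- w) q + (1 / w\<^sup>2 - q) * (theta (- w) q)\<^sup>2"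
      "theta (- (w * q)) q = theta (- w) q / w"
      using bsum_shift[OF q1 q0, of "- w"] theta_inverse(2)[OF q1 q0, of "- w"] w by simp_all
    show ?thesis
      unfolding E_def * bsum_shift[OF q1 q0 w] theta_inverse(2)[OF q1 q0 w] using w q0
      by (simp add: field_simps power2_eq_square)
  qed
  ultimately have "E z = E 1" using holomorphic_q_periodic_const[OF q1 q0] z by blast
  \<comment> \<open>This removes the term with the unevaluated \<open>bsum (- 1) q\<close> from
    \<open>E 1\<close>.\<close>
  moreover have "theta 1 q = 0" by (simp add: theta_def qpoch_inf_1[OF q1])
  moreover have "theta (- 1) q = 2 * (qpoch_inf (- q) q)\<^sup>2"
    using qpoch_inf_rec[OF q1, of "- 1"] by (simp add: theta_def power2_eq_square)
  ultimately have "E z = 4 * qpoch_inf (- q) q ^ 4 * qpoch_inf q q"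
    by (simp add: E_def bsum_1 power_mult_distrib flip: power_mult)
  then show ?thesis using z by (simp add: E_def field_simps)
qed

text \<open>The equality is termwise. Where a shifted product in \<open>hterm\<close> vanishes,
  \<open>qpoch\<close> is 0 by division by zero, so both sides are 0.\<close>

lemma g3c_eq: "g3c z q = hsum z q / theta z q"
proof -
  have "q powi (n\<^sup>2 + n) / qpochs [z, q / z] q (n + 1) = hterm z q n / theta z q" for n
  proof -
    have "q * q powi (n + 1) = q powi (n + 2)"
      using q0 power_int_add_1[of q "n + 1"] by (simp add: add.assoc mult.commute)
    then show ?thesis by (simp add: qpochs_def qpoch_def hterm_def theta_def)
  qed
  then show ?thesis
    by (simp add: g3c_def hsum_def divide_inverse infsum_cmult_left')
qed

lemma jtheta_eq: "jtheta z q = theta z q * qpoch_inf q q"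
  by (simp add: jtheta_def qpochs_inf_def theta_def)

text \<open>After inserting \<open>hsum_bsum\<close> at \<open>z\<close> and \<open>- z\<close>, the
  products of both squared thetas cancel because of the sign of \<open>- z\<close>; what is left is
  \<open>theta_bsum_identity\<close>.\<close>

lemma jtheta_g3c_identity:
  assumes z: "z \<noteq> 0" and nz: "theta z q \<noteq> 0" "theta (- z) q \<noteq> 0"
  shows "jtheta (- z) q * g3c z q + jtheta z q * g3c (- z) q
    = 4 * qpoch_inf (q\<^sup>2) (q\<^sup>2) ^ 5 / ((qpoch_inf q q)\<^sup>2 * jtheta (z\<^sup>2) (q\<^sup>2))"
proof -
  have "- (z * hsum (- z) q) = bsum (- z) q - (theta (- z) q)\<^sup>2"
    using hsum_bsum[OF q1 q0, of "- z"] z by simp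
  then have "z * hsum (- z) q = - (bsum (- z) q - (theta (- z) q)\<^sup>2)"
    by (metis minus_minus)
  note h = this hsum_bsum[OF q1 q0 z]
  have "z * ((theta (- z) q)\<^sup>2 * hsum z q + (theta z q)\<^sup>2 * hsum (- z) q)
      = (theta (- z) q)\<^sup>2 * (z * hsum z q) + (theta z q)\<^sup>2 * (z * hsum (- z) q)"
    by (simp add: algebra_simps)
  also have "\<dots> = z * (4 * qpoch_inf (- q) q ^ 4 * qpoch_inf q q)"
    unfolding h using theta_bsum_identity[OF z] by (simp add: algebra_simps)
  finally have main: "(theta (- z) q)\<^sup>2 * hsum z q + (theta z q)\<^sup>2 * hsum (- z) q
      = 4 * qpoch_inf (- q) q ^ 4 * qpoch_inf q q"
    using z by simp
  \<comment> \<open>This trades the fourth power of \<open>(-q; q)_inf\<close> for products in base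
    \<open>q\<close> and \<open>q^2\<close>.\<close>
  have sq: "qpoch_inf (q\<^sup>2) (q\<^sup>2) = qpoch_inf q q * qpoch_inf (- q) q"
    by (simp add: qpoch_inf_minus[OF q1])
  have "theta z q * theta (- z) q = (qpoch_inf z q * qpoch_inf (- z) q) * (qpoch_inf (q / z) q * qpoch_inf (- (q / z)) q)"
    by (simp add: theta_def mult_ac)
  also have "\<dots> = theta (z\<^sup>2) (q\<^sup>2)"
    unfolding qpoch_inf_minus[OF q1] by (simp add: theta_def power_divide)
  finally have jt: "jtheta (z\<^sup>2) (q\<^sup>2) = theta z q * theta (- z) q * qpoch_inf (q\<^sup>2) (q\<^sup>2)"
    by (simp add: jtheta_def qpochs_inf_def theta_def)
  have "norm (q\<^sup>2) < 1" using q1 by (simp add: norm_power power_less_one_iff)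
  then have J: "qpoch_inf (q\<^sup>2) (q\<^sup>2) \<noteq> 0" "qpoch_inf q q \<noteq> 0"
    using qpoch_inf_q_nonzero q1 by auto
  have "jtheta (- z) q * g3c z q + jtheta z q * g3c (- z) q
      = ((theta (- z) q)\<^sup>2 * hsum z q + (theta z q)\<^sup>2 * hsum (- z) q) * qpoch_inf q q / (theta z q * theta (- z) q)"
    unfolding jtheta_eq g3c_eq using nz by (simp add: field_simps power2_eq_square)
  also have "\<dots> = 4 * qpoch_inf (q\<^sup>2) (q\<^sup>2) ^ 4 / ((qpoch_inf q q)\<^sup>2 * (theta z q * theta (- z) q))"
    unfolding main sq using nz J by (simp add: field_simps power_mult_distrib eval_nat_numeral)
  \<comment> \<open>The fifth power arises from the factor \<open>(q^2; q^2)_inf\<close> contained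
    in \<open>jtheta\<close>.\<close>
  also have "\<dots> = 4 * qpoch_inf (q\<^sup>2) (q\<^sup>2) ^ 5 / ((qpoch_inf q q)\<^sup>2 * jtheta (z\<^sup>2) (q\<^sup>2))"
    unfolding jt using J by (simp add: eval_nat_numeral)
  finally show ?thesis .
qed

end

theorem theorem2p1:
  fixes q x :: complex
  assumes "norm q < 1" and "q \<noteq> 0" and "x \<noteq> 0"
    and "\<And>n :: int. qpochs [x * q, q\<^sup>2 / (x * q)] (q\<^sup>2) (n + 1) \<noteq> 0"
    and "\<And>n :: int. qpochs [- x * q, q\<^sup>2 / (- x * q)] (q\<^sup>2) (n + 1) \<noteq> 0"
    and "jtheta (x\<^sup>2 * q\<^sup>2) (q ^ 4) \<noteq> 0"
  shows "jtheta (- x * q) (q\<^sup>2) * g3c (x * q) (q\<^sup>2) + jtheta (x * q) (q\<^sup>2) * g3c (- x * q) (q\<^sup>2)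
    = 4 * Jfun q 4 ^ 5 / ((Jfun q 2)\<^sup>2 * jtheta (x\<^sup>2 * q\<^sup>2) (q ^ 4))"
proof -
  have "norm (q\<^sup>2) < 1" using assms(1) by (simp add: norm_power power_less_one_iff)
  \<comment> \<open>At \<open>n = -1\<close> the symbols have index 0 and are quotients of a product
    by itself; since \<open>0 / 0 = 0\<close>, their being nonzero says that the infinite products
    do not vanish.\<close>
  moreover have "theta (x * q) (q\<^sup>2) \<noteq> 0" "theta (- (x * q)) (q\<^sup>2) \<noteq> 0"
    using assms(4)[of "-1"] assms(5)[of "-1"] by (auto simp: qpochs_def qpoch_def theta_def)
  moreover have "(q\<^sup>2)\<^sup>2 = q ^ 4" by (simp flip: power_mult)
  ultimately show ?thesis
    using jtheta_g3c_identity[of "q\<^sup>2" "x * q"] assms(2,3) by (simp add: Jfun_def power_mult_distrib)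
qed

end
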